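(* Let $R$ be an exchange ring of bounded index in which the set $\operatorname{Nil}(R)$ of nilpotent elements is a subring. Then $\operatorname{Nil}(R)$ is an ideal of $R$.
   Context: Rings are associative and not necessarily unital. For $x,y\in R$ write $x\circ y=x+y-xy$. $R$ is an exchange ring if for every $a\in R$ there exist an idempotent $e\in R$ and $r,s\in R$ with $e=ra=s\circ a$. $R$ is of bounded index if there is a positive integer $n$ such that $x^n=0$ for all $x\in\operatorname{Nil}(R)$. *)

theory Defs
  imports Main
begin

text \<open>Rings are associative, not necessarily unital: we use the type class ring
(no 1 required). Since the library power operation needs a unit, positive powers
are defined directly: npow x n = x^n for n >= 1 (npow x 0 = 0 is a dummy value,
never used since all uses require n > 0).\<close>

fun npow :: "'a::ring \<Rightarrow> nat \<Rightarrow> 'a" where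
  "npow x 0 = 0"
| "npow x (Suc 0) = x"
| "npow x (Suc (Suc n)) = x * npow x (Suc n)"

definition circ :: "'a::ring \<Rightarrow> 'a \<Rightarrow> 'a" where
  "circ x y = x + y - x * y"

definition nil_set :: "'a::ring set" where
  "nil_set = {x. \<exists>n>0. npow x n = 0}"

definition exchange_ring :: "'a::ring itself \<Rightarrow> bool" where
  "exchange_ring _ \<longleftrightarrow>
     (\<forall>a::'a. \<exists>e r s. e * e = e \<and> e = r * a \<and> e = circ s a)"

definition bounded_index :: "'a::ring itself \<Rightarrow> bool" where
  "bounded_index _ \<longleftrightarrow> (\<exists>n>0. \<forall>x::'a \<in> nil_set. npow x n = 0)"

definition is_subring :: "'a::ring set \<Rightarrow> bool" where
  "is_subring S \<longleftrightarrow> 0 \<in> S \<and> (\<forall>x\<in>S. \<forall>y\<in>S. x - y \<in> S \<and> x * y \<in> S)"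

definition is_ideal :: "'a::ring set \<Rightarrow> bool" where
  "is_ideal I \<longleftrightarrow> 0 \<in> I \<and> (\<forall>x\<in>I. \<forall>y\<in>I. x - y \<in> I)
     \<and> (\<forall>x\<in>I. \<forall>r. r * x \<in> I \<and> x * r \<in> I)"

end

theory Submission
  imports Defs
begin

text \<open>
  If \<open>Nil(R)\<close> is a subring, the set \<open>Z\<close> of all \<open>x\<close> with \<open>Rx\<close> nil is the largest nil ideal, and
  \<open>R/Z\<close> is semiprime; the task is to show that \<open>R/Z\<close> is reduced. Working modulo \<open>Z\<close>, if \<open>xp = 0\<close>
  and \<open>x'p' = 0\<close>, then \<open>pRx\<close> and \<open>p'Rx'\<close> consist of nilpotents, hence so does their product, which
  forces \<open>xp'Rx'p = 0\<close>: in a prime ring this would say that the annihilators of elements form a chain.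

  Let \<open>u = 1 - a\<close> with \<open>a\<close> quasi-regular and \<open>yp = 0\<close>. If \<open>s = yup\<close> were nonzero, the annihilators of
  the elements \<open>y u^i\<close> would give an infinite chain, and the sums of elements \<open>u^i p c y u^(-i)\<close> with
  \<open>c\<close> in \<open>RsR\<close> would be nilpotents of arbitrarily large index. So \<open>yap = 0\<close> by bounded index.
  If \<open>y^2 = 0\<close>, the exchange property makes every \<open>byc\<close> quasi-regular, so \<open>ybycy = 0\<close> for all
  \<open>b, c\<close>, and semiprimeness gives \<open>y = 0\<close>.
\<close>

section \<open>Positive powers and nilpotent elements\<close>

lemma npow_Suc: "n > 0 \<Longrightarrow> npow x (Suc n) = x * npow x n"
  by (cases n) auto

lemma npow_add: "m > 0 \<Longrightarrow> n > 0 \<Longrightarrow> npow x (m + n) = npow x m * npow x n"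
proof (induction m)
  case (Suc m)
  then show ?case
    by (cases "m = 0") (auto simp: npow_Suc mult.assoc)
qed simp

lemma npow_mult: "m > 0 \<Longrightarrow> n > 0 \<Longrightarrow> npow (npow x m) n = npow x (m * n)"
proof (induction n)
  case (Suc n)
  then show ?case
    by (cases "n = 0") (auto simp: npow_Suc npow_add)
qed simp

lemma npow_swap: "npow (b * a) (Suc (Suc n)) = b * npow (a * b) (Suc n) * a"
  by (induction n) (auto simp: mult.assoc)

lemma npow_funpow: "npow x (Suc n) * z = (((*) x) ^^ Suc n) z"
  by (induction n) (auto simp: mult.assoc)

lemma nil_setI: "npow x n = 0 \<Longrightarrow> n > 0 \<Longrightarrow> x \<in> nil_set"
  by (auto simp: nil_set_def)

lemma nil_set_npowD:
  assumes "npow x k \<in> nil_set" "k > 0"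
  shows "x \<in> nil_set"
proof -
  obtain n where "n > 0" "npow (npow x k) n = 0"
    using assms by (auto simp: nil_set_def)
  then have "npow x (k * n) = 0" "k * n > 0"
    using assms by (auto simp: npow_mult)
  then show ?thesis by (rule nil_setI)
qed

lemma nil_set_squareD: "x * x \<in> nil_set \<Longrightarrow> x \<in> nil_set"
  using nil_set_npowD[of x 2] by (simp add: numeral_2_eq_2)

lemma nil_set_swap:
  assumes "a * b \<in> nil_set"
  shows "b * a \<in> nil_set"
proof -
  obtain n where "n > 0" "npow (a * b) n = 0"
    using assms by (auto simp: nil_set_def)
  then obtain m where "npow (a * b) (Suc m) = 0"
    by (metis gr0_implies_Suc)
  then have "npow (b * a) (Suc (Suc m)) = 0"
    by (simp only: npow_swap mult_zero_left mult_zero_right)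
  then show ?thesis by (rule nil_setI) simp
qed

lemma idempotent_nil_set_eq_0:
  assumes "e * e = e" "e \<in> nil_set"
  shows "e = 0"
proof -
  have "npow e (Suc n) = e" for n
    by (induction n) (auto simp: assms)
  with assms show ?thesis
    by (auto simp: nil_set_def) (metis gr0_implies_Suc)
qed

section \<open>Quasi-regular elements\<close>

lemma circ_assoc: "circ (circ x y) z = circ x (circ y z)"
  by (simp add: circ_def algebra_simps)

text \<open>In a unital overring \<open>circ a b = 0\<close> reads (1 - a)(1 - b) = 1, so this is
  invertibility of 1 - a, phrased without a unit.\<close>

definition quasi_regular :: "'a::ring \<Rightarrow> bool" where
  "quasi_regular a \<longleftrightarrow> (\<exists>b. circ a b = 0 \<and> circ b a = 0)"

text \<open>If \<open>1 - s\<close> inverts \<open>1 - ab\<close>, then \<open>1 + b(1 - s)a\<close> inverts \<open>1 - ba\<close>.\<close>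

lemma quasi_regular_swap:
  assumes "quasi_regular (a * b)"
  shows "quasi_regular (b * a)"
proof -
  obtain s where s: "a * b + s - a * b * s = 0" "s + a * b - s * (a * b) = 0"
    using assms by (auto simp: quasi_regular_def circ_def)
  let ?t = "b * s * a - b * a"
  have "circ (b * a) ?t = b * (a * b + s - a * b * s) * a - b * (a * b) * a + b * a * b * a"
    by (simp add: circ_def algebra_simps)
  moreover have "circ ?t (b * a) = b * (s + a * b - s * (a * b)) * a - b * (a * b) * a + b * a * b * a"
    by (simp add: circ_def algebra_simps)
  ultimately have "circ (b * a) ?t = 0" "circ ?t (b * a) = 0"
    unfolding s by (simp_all add: mult.assoc)
  then show ?thesis
    by (auto simp: quasi_regular_def)
qed

text \<open>A left quasi-inverse of \<open>a * y\<close> is again a left multiple of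
  \<open>y\<close>, so it has a left quasi-inverse too; associativity of \<open>circ\<close> makes
  both two-sided.\<close>

lemma quasi_regular_left_multiple:
  assumes "\<And>a. \<exists>s. circ s (a * y) = 0"
  shows "quasi_regular (a * y)"
proof -
  obtain s where s: "circ s (a * y) = 0"
    using assms by blast
  then have "s = (s * a - a) * y"
    by (simp add: circ_def algebra_simps)
  then obtain s' where s': "circ s' s = 0"
    using assms by metis
  have "s' = circ s' (circ s (a * y))"
    by (simp add: s) (simp add: circ_def)
  also have "\<dots> = a * y"
    by (simp add: circ_assoc[symmetric] s') (simp add: circ_def)
  finally show ?thesis
    using s s' by (auto simp: quasi_regular_def)
qed

section \<open>The largest nil ideal\<close>

definition nil_rad :: "'a::ring set" where
  "nil_rad = {x. \<forall>a. a * x \<in> nil_set}"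

lemma nil_rad_subset: "nil_rad \<subseteq> nil_set"
  by (auto simp: nil_rad_def intro: nil_set_squareD)

text \<open>The square of \<open>a * x\<close> is \<open>a * (x * a * x)\<close>.\<close>

lemma nil_rad_semiprime:
  assumes "\<And>a. x * a * x \<in> nil_rad"
  shows "x \<in> nil_rad"
proof -
  have "(a * x) * (a * x) \<in> nil_set" for a
    using assms[of a] by (auto simp: nil_rad_def mult.assoc)
  then show ?thesis
    unfolding nil_rad_def using nil_set_squareD by blast
qed

locale nil_subring =
  fixes ring_type :: "'a::ring itself"
  assumes is_subring_nil: "is_subring (nil_set :: 'a set)"
begin

lemma nil_set_0: "0 \<in> (nil_set :: 'a set)"
  and nil_set_diff: "x \<in> nil_set \<Longrightarrow> y \<in> nil_set \<Longrightarrow> x - y \<in> (nil_set :: 'a set)"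
  and nil_set_mult: "x \<in> nil_set \<Longrightarrow> y \<in> nil_set \<Longrightarrow> x * y \<in> (nil_set :: 'a set)"
  using is_subring_nil by (auto simp: is_subring_def)

lemma nil_rad_0: "0 \<in> (nil_rad :: 'a set)"
  by (simp add: nil_rad_def nil_set_0)

lemma nil_rad_diff: "x \<in> nil_rad \<Longrightarrow> y \<in> nil_rad \<Longrightarrow> x - y \<in> (nil_rad :: 'a set)"
  by (simp add: nil_rad_def nil_set_diff algebra_simps)

lemma nil_rad_add: "x \<in> nil_rad \<Longrightarrow> y \<in> nil_rad \<Longrightarrow> x + y \<in> (nil_rad :: 'a set)"
  using nil_rad_diff[of x "0 - y"] nil_rad_diff[of 0 y] nil_rad_0 by simp

lemma nil_rad_add_cancel: "y \<in> nil_rad \<Longrightarrow> x + y \<in> nil_rad \<longleftrightarrow> x \<in> (nil_rad :: 'a set)"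
  using nil_rad_diff[of "x + y" y] nil_rad_add[of x y] by auto

lemma nil_rad_sum: "(\<And>i. i \<in> A \<Longrightarrow> f i \<in> nil_rad) \<Longrightarrow> sum f A \<in> (nil_rad :: 'a set)"
  by (induction A rule: infinite_finite_induct) (auto intro: nil_rad_add nil_rad_0)

lemma nil_rad_mult_left: "x \<in> nil_rad \<Longrightarrow> a * x \<in> (nil_rad :: 'a set)"
  unfolding nil_rad_def by (auto simp: mult.assoc[symmetric])

lemma nil_rad_mult_right:
  assumes "x \<in> nil_rad"
  shows "x * a \<in> (nil_rad :: 'a set)"
proof -
  have "b * (x * a) \<in> nil_set" for b
    using assms nil_set_swap[of a "b * x"] by (simp add: nil_rad_def mult.assoc[symmetric])
  then show ?thesis by (simp add: nil_rad_def)
qed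

text \<open>Both \<open>p * b * x\<close> and \<open>p' * r * x'\<close> have squares in
  \<open>nil_rad\<close>; closure of the nilpotents under products and a cyclic shift of the factors
  do the rest.\<close>

lemma annihilator_comparison:
  assumes "x * p \<in> nil_rad" "x' * p' \<in> (nil_rad :: 'a set)"
  shows "x * p' * r * x' * p \<in> nil_rad"
proof -
  have nil: "q * b * z \<in> nil_set" if "z * q \<in> nil_rad" for q b z :: 'a
  proof -
    have "q * b * (z * q) * (b * z) \<in> nil_rad"
      by (rule nil_rad_mult_right, rule nil_rad_mult_left, rule that)
    then have "(q * b * z) * (q * b * z) \<in> nil_set"
      using nil_rad_subset by (auto simp: mult.assoc)
    then show ?thesis by (rule nil_set_squareD)
  qed
  have "b * (x * p' * r * x' * p) \<in> nil_set" for b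
  proof -
    have "(p * b * x) * (p' * r * x') \<in> nil_set"
      using assms by (intro nil_set_mult nil)
    then show ?thesis
      using nil_set_swap[of p "b * x * (p' * r * x')"] by (simp add: mult.assoc)
  qed
  then show ?thesis by (simp add: nil_rad_def)
qed

text \<open>
  With \<open>u = 1 - a\<close>, the elements \<open>P i\<close> and \<open>Y i\<close> below are \<open>u^i p\<close> and \<open>y u^(-i)\<close>,
  so \<open>Y i * P j\<close> depends only on \<open>j - i\<close>.
\<close>

lemma quasi_regular_preserves_annihilator:
  fixes a y p :: 'a
  assumes n: "n > 0" "\<And>x::'a. x \<in> nil_set \<Longrightarrow> npow x n = 0"
    and "quasi_regular a" and yp: "y * p \<in> nil_rad"
  shows "y * a * p \<in> nil_rad"
proof -
  obtain a' where a': "a + a' - a * a' = 0" "a' + a - a' * a = 0"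
    using \<open>quasi_regular a\<close> by (auto simp: quasi_regular_def circ_def)
  define P where "P i = ((\<lambda>q. q - a * q) ^^ i) p" for i
  define Y where "Y i = ((\<lambda>z. z - z * a') ^^ i) y" for i
  define s where "s = y * p - y * a * p"
  have P_0: "P 0 = p" and P_Suc: "P (Suc i) = P i - a * P i" for i
    by (simp_all add: P_def)
  have Y_0: "Y 0 = y" and Y_Suc: "Y (Suc i) = Y i - Y i * a'" for i
    by (simp_all add: Y_def)
  have cancel: "(z - z * a') * (q - a * q) = z * q" for z q
  proof -
    have "(z - z * a') * (q - a * q) = z * q - z * (a' + a - a' * a) * q"
      by (simp add: algebra_simps)
    then show ?thesis by (simp add: a')
  qed
  have cancel': "(z - z * a) * (q - a' * q) = z * q" for z q
  proof -
    have "(z - z * a) * (q - a' * q) = z * q - z * (a + a' - a * a') * q"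
      by (simp add: algebra_simps)
    then show ?thesis by (simp add: a')
  qed
  have YP_shift: "Y (i + k) * P (j + k) = Y i * P j" for i j k
    by (induction k) (simp_all add: P_Suc Y_Suc cancel)
  have "Y i * P (Suc i) = s" for i
    using YP_shift[of 0 i 1] by (simp add: P_Suc P_0 Y_0 s_def algebra_simps)
  then have YP_Suc: "z * Y i * P (Suc i) = z * s" for z i
    by (simp add: mult.assoc)
  \<comment> \<open>Induction step: compare the pair (\<open>s * r * Y k\<close>, \<open>p\<close>)
    with (yu, u^(-1)p). The trailing factor yup is \<open>s\<close>, so semiprimeness applies to
    \<open>?v\<close>.\<close>
  have s_Y_p: "s * r * (Y k * p) \<in> nil_rad" for k r
  proof (induction k arbitrary: r)
    case 0
    show ?case
      by (simp add: Y_0 yp nil_rad_mult_left)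
  next
    case (Suc k)
    let ?v = "s * r * (Y (Suc k) * p)"
    have v: "s * r * Y k * (p - a' * p) = ?v"
      by (simp add: Y_Suc algebra_simps)
    have "s * r * Y k * p \<in> nil_rad"
      using Suc.IH by (simp add: mult.assoc)
    moreover have "(y - y * a) * (p - a' * p) \<in> nil_rad"
      by (simp add: cancel' yp)
    ultimately have "s * r * Y k * (p - a' * p) * b * (y - y * a) * p \<in> nil_rad" for b
      by (rule annihilator_comparison)
    moreover have "(y - y * a) * p = s"
      by (simp add: s_def algebra_simps)
    ultimately have "?v * b * s \<in> nil_rad" for b
      unfolding v by (simp add: mult.assoc)
    then have "?v * b * s * (r * (Y (Suc k) * p)) \<in> nil_rad" for b
      by (rule nil_rad_mult_right)
    then have "?v * b * ?v \<in> nil_rad" for b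
      by (simp add: mult.assoc)
    then show ?case
      by (rule nil_rad_semiprime)
  qed
  have "d * s \<in> nil_set" for d
  proof -
    \<comment> \<open>The factor \<open>s\<close> puts \<open>c * (Y i * P j)\<close> into
      \<open>nil_rad\<close> for j <= i.\<close>
    define c where "c = d * s * d"
    define t where "t = (\<Sum>i\<le>n. P i * c * Y i)"
    \<comment> \<open>Iterated left multiplication replaces powers of \<open>t\<close>, so that
      exponent 0 is the identity and not the dummy value.\<close>
    define T where "T k = ((*) t) ^^ k" for k
    have T_0: "T 0 x = x" and T_Suc: "T (Suc k) x = T k (t * x)"
      and T_Suc': "T (Suc k) x = t * T k x" for k x
      by (simp_all add: T_def funpow_swap1)
    have T_add: "T k (x + z) = T k x + T k z" for k x z
      by (induction k) (simp_all add: T_0 T_Suc' distrib_left)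
    have T_sum: "T k (sum f A) = (\<Sum>i\<in>A. T k (f i))" if "finite A" for k f and A :: "nat set"
      using that
    proof (induction A)
      case empty
      show ?case by (induction k) (simp_all add: T_0 T_Suc')
    qed (simp add: T_add)
    have T_mult: "T k (x * z) = T k x * z" for k x z
      by (induction k) (simp_all add: T_0 T_Suc' mult.assoc)
    have T_nil_rad: "x \<in> nil_rad \<Longrightarrow> T k x \<in> nil_rad" for k x
      by (induction k) (simp_all add: T_0 T_Suc' nil_rad_mult_left)
    have c_YP: "c * (Y i * P j) \<in> nil_rad" if "j \<le> i" for i j
    proof -
      have "Y i * P j = Y (i - j) * p"
        using YP_shift[of "i - j" j 0] that by (simp add: P_0)
      moreover have "d * (s * d * (Y (i - j) * p)) \<in> nil_rad"
        by (rule nil_rad_mult_left[OF s_Y_p])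
      ultimately show ?thesis by (simp add: c_def mult.assoc)
    qed
    \<comment> \<open>Modulo \<open>nil_rad\<close>, \<open>t\<close> acts strictly triangularly on
      the elements \<open>P j * c\<close>; by \<open>YP_Suc\<close> the coefficient at
      \<open>P (j - 1) * c\<close> is \<open>s * c\<close>.\<close>
    have t_P: "\<exists>z\<in>nil_rad. t * P j * c = (\<Sum>i<j. P i * c * (Y i * P j * c)) + z" if "j \<le> n" for j
    proof
      let ?z = "\<Sum>i\<in>{j..n}. P i * (c * (Y i * P j)) * c"
      show "?z \<in> nil_rad"
        by (rule nil_rad_sum, rule nil_rad_mult_right, rule nil_rad_mult_left, rule c_YP) simp
      have "{..n} = {..<j} \<union> {j..n}" "{..<j} \<inter> {j..n} = {}"
        using that by auto
      then show "t * P j * c = (\<Sum>i<j. P i * c * (Y i * P j * c)) + ?z"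
        by (simp add: t_def sum_distrib_right sum.union_disjoint distrib_right mult.assoc)
    qed
    have T_P: "T (Suc k) (P j * c) \<in> nil_rad" if "j \<le> k" "j \<le> n" for j k
      using that
    proof (induction k arbitrary: j)
      case 0
      with t_P[of 0] show ?case
        by (auto simp: T_Suc T_0 mult.assoc)
    next
      case (Suc k)
      obtain z where z: "z \<in> nil_rad"
        "t * P j * c = (\<Sum>i<j. P i * c * (Y i * P j * c)) + z"
        using t_P Suc.prems by blast
      have "T (Suc (Suc k)) (P j * c) = (\<Sum>i<j. T (Suc k) (P i * c) * (Y i * P j * c)) + T (Suc k) z"
        by (subst T_Suc) (simp only: mult.assoc[symmetric] z T_add T_sum finite_lessThan T_mult)
      moreover have "\<dots> \<in> nil_rad"
        using Suc z by (intro nil_rad_add nil_rad_sum nil_rad_mult_right) (auto intro: T_nil_rad)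
      ultimately show ?case by simp
    qed
    \<comment> \<open>Of t^j P_j c only the path lowering the index by one at each step survives,
      leaving P_0 c (sc)^j.\<close>
    have T_P_diag: "x * T j (P j * c) * w \<in> nil_rad \<Longrightarrow>
        x * P 0 * c * ((\<lambda>v. s * c * v) ^^ j) w \<in> nil_rad" if "j \<le> n" for j x w
      using that
    proof (induction j arbitrary: w)
      case 0
      then show ?case by (simp add: T_0 mult.assoc)
    next
      case (Suc j)
      obtain z where z: "z \<in> nil_rad"
        "t * P (Suc j) * c = (\<Sum>i<Suc j. P i * c * (Y i * P (Suc j) * c)) + z"
        using t_P Suc.prems by blast
      let ?r = "(\<Sum>i<j. T j (P i * c) * (Y i * P (Suc j) * c)) + T j z"
      have step: "T (Suc j) (P (Suc j) * c) = T j (P j * c) * (s * c) + ?r"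
        by (subst T_Suc) (simp only: mult.assoc[symmetric] z T_add T_sum finite_lessThan T_mult
            sum.lessThan_Suc YP_Suc add_ac)
      have "?r \<in> nil_rad"
      proof (intro nil_rad_add nil_rad_sum nil_rad_mult_right T_nil_rad[OF z(1)])
        fix i assume "i \<in> {..<j}"
        then show "T j (P i * c) \<in> nil_rad"
          using T_P[of i "j - 1"] Suc.prems by auto
      qed
      then have r: "x * ?r * w \<in> nil_rad"
        by (rule nil_rad_mult_right[OF nil_rad_mult_left])
      have split: "x * (T j (P j * c) * (s * c) + ?r) * w =
          x * T j (P j * c) * (s * c * w) + x * ?r * w"
        by (simp only: distrib_left distrib_right mult.assoc)
      have "x * T j (P j * c) * (s * c * w) \<in> nil_rad"
        using Suc.prems(1) unfolding step split nil_rad_add_cancel[OF r] .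
      then have "x * P 0 * c * ((\<lambda>v. s * c * v) ^^ j) (s * c * w) \<in> nil_rad"
        using Suc by simp
      then show ?case
        by (simp add: funpow_swap1)
    qed
    have "T (Suc n) t = (\<Sum>i\<le>n. T (Suc n) (P i * c) * Y i)"
      by (subst t_def) (simp only: T_sum finite_atMost T_mult)
    also have "\<dots> \<in> nil_rad"
      by (intro nil_rad_sum nil_rad_mult_right T_P) auto
    finally have "npow t (Suc (Suc n)) \<in> nil_set"
      using nil_rad_subset npow_funpow[of t n t] npow_add[of "Suc n" 1 t] by (auto simp: T_def)
    then have "t \<in> nil_set"
      by (rule nil_set_npowD) simp
    \<comment> \<open>With n + 1 indices, triangularity alone does not give t^n = 0; the index bound
      does.\<close>
    then have "npow t n = 0"
      by (rule n)
    then have "T n x = 0" for x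
      using npow_funpow[of t "n - 1" x] \<open>n > 0\<close> by (simp add: T_def)
    then have "(y - y * a) * T n (P n * c) * s \<in> nil_rad"
      by (simp add: nil_rad_0)
    then have "(y - y * a) * P 0 * c * ((\<lambda>v. s * c * v) ^^ n) s \<in> nil_rad"
      by (intro T_P_diag) auto
    moreover have "(y - y * a) * P 0 = s"
      by (simp add: s_def P_0 algebra_simps)
    ultimately have "d * (s * c * ((\<lambda>v. s * c * v) ^^ n) s) \<in> nil_rad"
      by (simp add: nil_rad_mult_left)
    then have "d * ((\<lambda>v. s * c * v) ^^ Suc n) s \<in> nil_set"
      using nil_rad_subset by auto
    \<comment> \<open>Each factor \<open>s * c\<close>, that is \<open>s * d * s * d\<close>, adds
      two factors \<open>d * s\<close>.\<close>
    moreover have "d * ((\<lambda>v. s * c * v) ^^ k) s = npow (d * s) (Suc (2 * k))" for k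
    proof (induction k)
      case (Suc k)
      have "d * ((\<lambda>v. s * c * v) ^^ Suc k) s = d * s * (d * s * (d * ((\<lambda>v. s * c * v) ^^ k) s))"
        by (simp add: c_def mult.assoc)
      then show ?case
        using Suc by simp
    qed simp
    ultimately have "npow (d * s) (Suc (2 * Suc n)) \<in> nil_set"
      by metis
    then show ?thesis
      by (rule nil_set_npowD) simp
  qed
  then have "s \<in> nil_rad"
    by (simp add: nil_rad_def)
  then have "y * p - s \<in> nil_rad"
    using yp nil_rad_diff by blast
  then show ?thesis
    by (simp add: s_def)
qed

section \<open>Exchange rings: the quotient by the largest nil ideal is reduced\<close>

lemma exchange_quasi_regular:
  fixes a y :: 'a
  assumes "exchange_ring TYPE('a)" "y * y \<in> nil_rad"
  shows "quasi_regular (a * y)"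
proof (rule quasi_regular_left_multiple)
  fix a :: 'a
  obtain e r s where e: "e * e = e" "e = r * (a * y)" "e = circ s (a * y)"
    using assms(1) unfolding exchange_ring_def by meson
  have ey: "e * y \<in> nil_rad"
    using nil_rad_mult_left[OF assms(2), of "r * a"] by (simp add: e(2) mult.assoc)
  \<comment> \<open>Here \<open>?x * y\<close> agrees with \<open>e\<close> modulo
    \<open>nil_rad\<close>, so comparing the pairs (\<open>e\<close>, \<open>y\<close>) and
    (\<open>?x\<close>, \<open>e\<close>) yields \<open>e * b * e\<close>.\<close>
  let ?x = "r * a - r * a * e"
  have "?x * e = 0"
    by (simp add: left_diff_distrib mult.assoc e(1))
  then have "e * e * b * ?x * y \<in> nil_rad" for b
    using annihilator_comparison[OF ey, of ?x e b] nil_rad_0 by simp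
  moreover have "e * e * b * ?x * y = e * b * (r * (a * y)) - e * b * r * a * (e * y)" for b
    by (simp add: e(1) algebra_simps)
  ultimately have "e * b * e - e * b * r * a * (e * y) \<in> nil_rad" for b
    using e(2) by metis
  then have "e * b * e \<in> nil_rad" for b
    using nil_rad_add[OF _ nil_rad_mult_left[OF ey]] by (metis diff_add_cancel)
  then have "e \<in> nil_rad"
    by (rule nil_rad_semiprime)
  then have "e = 0"
    using nil_rad_subset e(1) idempotent_nil_set_eq_0 by blast
  then show "\<exists>s. circ s (a * y) = 0"
    using e(3) by metis
qed

lemma nil_rad_reduced:
  fixes y :: 'a
  assumes "exchange_ring TYPE('a)" "bounded_index TYPE('a)" and yy: "y * y \<in> nil_rad"
  shows "y \<in> nil_rad"
proof -
  obtain n where n: "n > 0" "\<And>x::'a. x \<in> nil_set \<Longrightarrow> npow x n = 0"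
    using assms(2) by (auto simp: bounded_index_def)
  have "y * (b * y * c) * y \<in> nil_rad" for b c
  proof (rule quasi_regular_preserves_annihilator[OF n _ yy])
    show "quasi_regular (b * y * c)"
      using quasi_regular_swap[of c "b * y"] exchange_quasi_regular[OF assms(1) yy, of "c * b"]
      by (simp add: mult.assoc)
  qed
  \<comment> \<open>The extra factor \<open>b * y\<close> creates the pattern zcz with z = yby, so
    semiprimeness can be used twice.\<close>
  then have "y * b * y * c * (y * b * y) \<in> nil_rad" for b c
    using nil_rad_mult_right[of "y * (b * y * c) * y" "b * y"] by (simp add: mult.assoc)
  then have "y * b * y \<in> nil_rad" for b
    by (rule nil_rad_semiprime)
  then show ?thesis
    by (rule nil_rad_semiprime)
qed

end

theorem theorem3p7:
  assumes "exchange_ring TYPE('a::ring)"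
    and "bounded_index TYPE('a)"
    and "is_subring (nil_set :: 'a set)"
  shows "is_ideal (nil_set :: 'a set)"
proof -
  interpret nil_subring "TYPE('a)"
    using assms(3) by unfold_locales
  \<comment> \<open>The exponent drops by one at a time: the square of x^(k+1) is a multiple of
    x^(k+2).\<close>
  have nil_rad_npowD: "x \<in> nil_rad" if "npow x (Suc k) \<in> nil_rad" for x :: 'a and k
    using that
  proof (induction k)
    case (Suc k)
    have "npow x (Suc k) * npow x (Suc k) = npow x (Suc k + Suc k)"
      by (rule npow_add[symmetric]) auto
    also have "\<dots> \<in> nil_rad"
      using Suc.prems nil_rad_mult_right[OF Suc.prems, of "npow x k"]
        npow_add[of "Suc (Suc k)" k x] by (cases "k = 0") auto
    finally show ?case
      using Suc.IH nil_rad_reduced assms(1,2) by blast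
  qed simp
  have "x \<in> nil_rad" if "x \<in> nil_set" for x :: 'a
  proof -
    obtain k where "npow x (Suc k) = 0"
      using \<open>x \<in> nil_set\<close> unfolding nil_set_def by (auto dest: gr0_implies_Suc)
    then show ?thesis
      using nil_rad_npowD[of x k] nil_rad_0 by simp
  qed
  then have "nil_set = (nil_rad :: 'a set)"
    using nil_rad_subset by blast
  then show ?thesis
    by (auto simp: is_ideal_def nil_rad_0 nil_rad_diff nil_rad_mult_left nil_rad_mult_right)
qed

end
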